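(* For $2\le k<n$, every deterministic online algorithm for Caching in Matchings (on bipartite graphs with $n$ nodes per side and $k$ matchings) has competitive ratio $\Omega(n/k)$.
   Context: Caching in Matchings (bipartite version): there are two disjoint node sets $V^{in}$ and $V^{out}$, each of size $n$. Requests arrive online, each being an edge $(u,v)\in V^{in}\times V^{out}$. The algorithm maintains a cache $M$ which is the union of $k$ matchings (a properly $k$-edge-colored set of edges). If a requested edge is in none of the matchings, the algorithm must insert it into one of the matchings, evicting from that matching the edges incident to its endpoints. The algorithm may add any edge to any matching at any time (keeping each a matching) and may evict freely; each addition of an edge to a matching costs $1$ (so recoloring an edge costs $1$). An online algorithm $A$ is $c$-competitive if there is $d=d(n,k)$ with $\mathrm{cost}(A(\sigma))\le c\cdot\mathrm{cost}(OPT(\sigma))+d$ for every request sequence $\sigma$, where $OPT$ is the optimal offline cost with $k$ matchings. *)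

theory Defs
  imports Complex_Main "HOL-Library.Extended_Real"
begin

text \<open>
  Both sides of the bipartition are \<open>{..<n}\<close>. They are kept apart by the position in the
  pair: an edge \<open>(u, v)\<close> joins the \<open>u\<close>-th node of \<open>V\<^sup>i\<^sup>n\<close> to the \<open>v\<close>-th node of \<open>V\<^sup>o\<^sup>u\<^sup>t\<close>.
\<close>

type_synonym edge = "nat \<times> nat"

definition edges :: "nat \<Rightarrow> edge set" where
  "edges n = {..<n} \<times> {..<n}"

definition matching :: "edge set \<Rightarrow> bool" where
  "matching X \<longleftrightarrow> (\<forall>e\<in>X. \<forall>f\<in>X. e \<noteq> f \<longrightarrow> fst e \<noteq> fst f \<and> snd e \<noteq> snd f)"

text \<open>
  A cache maps each colour \<open>i < k\<close> to the matching of that colour; values at \<open>i \<ge> k\<close> are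
  irrelevant. The matchings are pairwise disjoint, as every cached edge has a single colour.
\<close>

type_synonym cache = "nat \<Rightarrow> edge set"

definition valid_cache :: "nat \<Rightarrow> nat \<Rightarrow> cache \<Rightarrow> bool" where
  "valid_cache n k M \<longleftrightarrow>
     (\<forall>i<k. M i \<subseteq> edges n \<and> matching (M i)) \<and>
     (\<forall>i<k. \<forall>j<k. i \<noteq> j \<longrightarrow> M i \<inter> M j = {})"

definition cached :: "nat \<Rightarrow> cache \<Rightarrow> edge \<Rightarrow> bool" where
  "cached k M e \<longleftrightarrow> (\<exists>i<k. e \<in> M i)"

definition empty_cache :: cache where
  "empty_cache = (\<lambda>_. {})"

text \<open>
  Only additions are charged. An edge that moves from colour \<open>i\<close> to colour \<open>j\<close> is counted
  once, in the summand of \<open>j\<close>.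
\<close>

definition add_cost :: "nat \<Rightarrow> cache \<Rightarrow> cache \<Rightarrow> nat" where
  "add_cost k M M' = (\<Sum>i<k. card (M' i - M i))"

fun path_cost :: "nat \<Rightarrow> cache \<Rightarrow> cache list \<Rightarrow> nat" where
  "path_cost k M [] = 0"
| "path_cost k M (M' # Ms) = add_cost k M M' + path_cost k M' Ms"

text \<open>
  A schedule lists, for each request, the successive caches the algorithm moves through while
  handling it; the empty list means that the cache is left unchanged. The requested edge must
  be present when the request arrives or at some moment while it is handled, and it may be
  evicted again afterwards.
\<close>

type_synonym schedule = "cache list list"

definition cache_before :: "schedule \<Rightarrow> nat \<Rightarrow> cache" where
  "cache_before S t = last (empty_cache # concat (take t S))"

definition feasible :: "nat \<Rightarrow> nat \<Rightarrow> edge list \<Rightarrow> schedule \<Rightarrow> bool" where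
  "feasible n k \<sigma> S \<longleftrightarrow>
     length S = length \<sigma> \<and>
     (\<forall>t<length \<sigma>. (\<forall>M\<in>set (S ! t). valid_cache n k M) \<and>
        (\<exists>M\<in>set (cache_before S t # S ! t). cached k M (\<sigma> ! t)))"

definition cost :: "nat \<Rightarrow> schedule \<Rightarrow> nat" where
  "cost k S = path_cost k empty_cache (concat S)"

definition opt_cost :: "nat \<Rightarrow> nat \<Rightarrow> edge list \<Rightarrow> nat" where
  "opt_cost n k \<sigma> = Inf {cost k S | S. feasible n k \<sigma> S}"

text \<open>
  The reaction of a deterministic online algorithm to a request is a function of the requests
  seen so far, the current one (the last element of the list) included.
\<close>

type_synonym online_alg = "edge list \<Rightarrow> cache list"

definition run :: "online_alg \<Rightarrow> edge list \<Rightarrow> schedule" where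
  "run A \<sigma> = map (\<lambda>t. A (take (Suc t) \<sigma>)) [0..<length \<sigma>]"

definition online_algorithm :: "nat \<Rightarrow> nat \<Rightarrow> online_alg \<Rightarrow> bool" where
  "online_algorithm n k A \<longleftrightarrow> (\<forall>\<sigma>\<in>lists (edges n). feasible n k \<sigma> (run A \<sigma>))"

definition competitive :: "nat \<Rightarrow> nat \<Rightarrow> online_alg \<Rightarrow> real \<Rightarrow> bool" where
  "competitive n k A c \<longleftrightarrow>
     (\<exists>d::real. \<forall>\<sigma>\<in>lists (edges n).
        real (cost k (run A \<sigma>)) \<le> c * real (opt_cost n k \<sigma>) + d)"

text \<open>The ratio is \<open>\<infinity>\<close> if the algorithm is not \<open>c\<close>-competitive for any \<open>c\<close>.\<close>

definition competitive_ratio :: "nat \<Rightarrow> nat \<Rightarrow> online_alg \<Rightarrow> ereal" where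
  "competitive_ratio n k A = Inf {ereal c | c. competitive n k A c}"

text \<open>
  Online algorithms exist, and the infimum defining \<^const>\<open>opt_cost\<close> is attained.
\<close>

lemma online_algorithm_exists:
  assumes "k \<ge> 1"
  shows "online_algorithm n k (\<lambda>\<sigma>. [\<lambda>i. if i = 0 then {last \<sigma>} else {}])"
  unfolding online_algorithm_def feasible_def
proof (intro ballI conjI allI impI)
  fix \<sigma> :: "edge list" and t
  let ?A = "\<lambda>\<sigma>. [\<lambda>i. if i = 0 then {last \<sigma>} else {}] :: cache list"
  assume \<sigma>: "\<sigma> \<in> lists (edges n)" and t: "t < length \<sigma>"
  have r: "run ?A \<sigma> ! t = [\<lambda>i. if i = 0 then {\<sigma> ! t} else {}]"
    using t by (simp add: run_def take_Suc_conv_app_nth cong: if_cong)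
  have e: "\<sigma> ! t \<in> edges n"
    using \<sigma> t by (auto simp: lists_eq_set)
  show "\<exists>M\<in>set (cache_before (run ?A \<sigma>) t # run ?A \<sigma> ! t). cached k M (\<sigma> ! t)"
    unfolding r using assms by (auto simp: cached_def intro: exI[of _ 0])
  show "valid_cache n k M" if "M \<in> set (run ?A \<sigma> ! t)" for M
    using that e unfolding r by (auto simp: valid_cache_def matching_def)
qed (simp add: run_def)

lemma opt_cost_attained:
  assumes "k \<ge> 1" and "\<sigma> \<in> lists (edges n)"
  shows "\<exists>S. feasible n k \<sigma> S \<and> opt_cost n k \<sigma> = cost k S"
proof -
  have "{cost k S | S. feasible n k \<sigma> S} \<noteq> {}"
    using online_algorithm_exists[OF assms(1)] assms(2) unfolding online_algorithm_def by blast
  from Inf_nat_def1[OF this] show ?thesis unfolding opt_cost_def by blast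
qed

end

theory Submission imports Defs "HOL-Number_Theory.Cong" begin

text \<open>
  A copy of \<open>K\<^sub>k\<^sub>,\<^sub>k\<close> with one edge \<open>(u, v)\<close> removed transmits a colour: in a proper colouring
  with \<open>k\<close> colours the colour missing at \<open>u\<close> is the one missing at \<open>v\<close>. Chain \<open>2L\<close> such blocks,
  \<open>L \<approx> n / 2k\<close>, by links from the \<open>u\<close> of a block to the \<open>v\<close> of the next one; the last link ends
  in an extra node \<open>w\<close>. If everything is cached, all links have the same colour. If the middle
  link is replaced by an edge to \<open>w\<close>, the two halves of the chain must have different
  colours. So whoever alternates between the two graphs and caches each of them completely
  recolours about \<open>L\<close> links per change; an algorithm that does not cache the current
  graph is punished by requests to missing edges. Offline, one can fix a position \<open>p\<close> in the second
  half, use one colour before \<open>p\<close> and another one after \<open>p\<close>, and never keep the link \<open>p\<close>. A change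
  of the graph then costs \<open>1\<close>, and averaging over the \<open>L\<close> positions makes the requests to the
  link \<open>p\<close> cost \<open>O(1)\<close> per change as well.
\<close>

section \<open>Costs of schedules\<close>

definition final_cache :: "schedule \<Rightarrow> cache" where
  "final_cache S = last (empty_cache # concat S)"

lemma last_Cons_append: "last (x # xs @ ys) = last (last (x # xs) # ys)"
  by (cases ys) auto

lemma path_cost_append:
  "path_cost k M (xs @ ys) = path_cost k M xs + path_cost k (last (M # xs)) ys"
  by (induction xs arbitrary: M) auto

lemma final_cache_append: "final_cache (S @ T) = last (final_cache S # concat T)"
  unfolding final_cache_def by (simp only: concat_append last_Cons_append)

lemma final_cache_snoc: "final_cache (S @ [Ms]) = last (final_cache S # Ms)"
  by (simp add: final_cache_append)

lemma cost_append: "cost k (S @ T) = cost k S + path_cost k (final_cache S) (concat T)"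
  by (simp add: cost_def path_cost_append final_cache_def)

lemma cost_snoc: "cost k (S @ [Ms]) = cost k S + path_cost k (final_cache S) Ms"
  by (simp add: cost_append)

lemma cache_before_append: "t \<le> length S \<Longrightarrow> cache_before (S @ T) t = cache_before S t"
  by (simp add: cache_before_def)

lemma cache_before_length: "cache_before S (length S) = final_cache S"
  by (simp add: cache_before_def final_cache_def)

lemma feasible_snoc:
  "feasible n k (\<sigma> @ [e]) (S @ [Ms]) \<longleftrightarrow>
     feasible n k \<sigma> S \<and> (\<forall>M\<in>set Ms. valid_cache n k M) \<and>
     (\<exists>M\<in>set (final_cache S # Ms). cached k M e)"
proof (cases "length S = length \<sigma>")
  case True
  have "cache_before (S @ [Ms]) (length \<sigma>) = final_cache S"
    using True cache_before_append[of "length S" S "[Ms]"] cache_before_length[of S] by simp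
  moreover have "cache_before (S @ [Ms]) t = cache_before S t" if "t < length \<sigma>" for t
    using that True by (simp add: cache_before_append)
  ultimately show ?thesis
    using True unfolding feasible_def
    by (auto simp: less_Suc_eq nth_append all_conj_distrib)
qed (auto simp: feasible_def)

section \<open>Valid caches and the cost of moving between them\<close>

lemma feasible_valid:
  assumes "feasible n k \<sigma> S" "M \<in> set (concat S)"
  shows "valid_cache n k M"
proof -
  obtain t where "t < length S" "M \<in> set (S ! t)"
    using assms(2) by (metis UN_E in_set_conv_nth set_concat)
  then show ?thesis using assms(1) by (auto simp: feasible_def)
qed

lemma valid_empty_cache: "valid_cache n k empty_cache"
  by (simp add: valid_cache_def empty_cache_def matching_def)

lemma final_cache_valid: "feasible n k \<sigma> S \<Longrightarrow> valid_cache n k (final_cache S)"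
  unfolding final_cache_def
  using feasible_valid valid_empty_cache by (metis last_in_set set_ConsD list.discI)

lemma valid_cache_finite: "valid_cache n k M \<Longrightarrow> i < k \<Longrightarrow> finite (M i)"
  unfolding valid_cache_def edges_def by (meson finite_SigmaI finite_lessThan finite_subset)

lemma valid_cache_unique:
  "\<lbrakk>valid_cache n k M; i < k; j < k; e \<in> M i; e \<in> M j\<rbrakk> \<Longrightarrow> i = j"
  unfolding valid_cache_def by blast

lemma valid_cache_fst:
  "\<lbrakk>valid_cache n k M; i < k; (x, y) \<in> M i; (x, y') \<in> M i\<rbrakk> \<Longrightarrow> y = y'"
  unfolding valid_cache_def matching_def by fastforce

lemma valid_cache_snd:
  "\<lbrakk>valid_cache n k M; i < k; (x, y) \<in> M i; (x', y) \<in> M i\<rbrakk> \<Longrightarrow> x = x'"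
  unfolding valid_cache_def matching_def by fastforce

text \<open>An edge of \<open>M'' i\<close> outside \<open>M i\<close> is added either on the way to
  \<open>M'\<close> or after it. Validity supplies finiteness, since \<open>card\<close> is 0 on
  infinite sets.\<close>

lemma add_cost_triangle:
  assumes "valid_cache n k M'" "valid_cache n k M''"
  shows "add_cost k M M'' \<le> add_cost k M M' + add_cost k M' M''"
  unfolding add_cost_def sum.distrib[symmetric]
proof (rule sum_mono)
  fix i assume "i \<in> {..<k}"
  then have "finite (M' i)" "finite (M'' i)" using assms by (auto dest: valid_cache_finite)
  then have "card (M'' i - M i) \<le> card ((M' i - M i) \<union> (M'' i - M' i))"
    by (intro card_mono) auto
  also have "\<dots> \<le> card (M' i - M i) + card (M'' i - M' i)" by (rule card_Un_le)
  finally show "card (M'' i - M i) \<le> card (M' i - M i) + card (M'' i - M' i)" .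
qed

lemma add_cost_same [simp]: "add_cost k M M = 0"
  by (simp add: add_cost_def)

lemma add_cost_le_path_cost:
  assumes "\<forall>M'\<in>set Ms. valid_cache n k M'"
  shows "add_cost k M (last (M # Ms)) \<le> path_cost k M Ms"
  using assms
proof (induction Ms arbitrary: M)
  case (Cons M' Ms)
  have "last (M' # Ms) \<in> set (M' # Ms)" by (rule last_in_set) simp
  then have "valid_cache n k (last (M' # Ms))" using Cons.prems by blast
  then have "add_cost k M (last (M' # Ms)) \<le> add_cost k M M' + add_cost k M' (last (M' # Ms))"
    using Cons.prems by (intro add_cost_triangle) auto
  then show ?case using Cons.IH[of M'] Cons.prems by simp
qed simp

lemma card_le_add_cost:
  assumes "valid_cache n k M'" "i < k" "D \<subseteq> M' i - M i"
  shows "card D \<le> add_cost k M M'"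
proof -
  have "card D \<le> card (M' i - M i)"
    using assms valid_cache_finite by (intro card_mono) auto
  also have "\<dots> \<le> add_cost k M M'"
    unfolding add_cost_def using assms(2) by (intro member_le_sum) auto
  finally show ?thesis .
qed

lemma path_cost_miss:
  assumes "\<forall>M'\<in>set Ms. valid_cache n k M'" "\<not> cached k M e" "\<exists>M'\<in>set Ms. cached k M' e"
  shows "1 \<le> path_cost k M Ms"
  using assms
proof (induction Ms arbitrary: M)
  case (Cons M' Ms)
  show ?case
  proof (cases "cached k M' e")
    case True
    then obtain i where "i < k" "{e} \<subseteq> M' i - M i"
      using Cons.prems(2) by (auto simp: cached_def)
    then have "card {e} \<le> add_cost k M M'"
      using Cons.prems(1) card_le_add_cost by (metis list.set_intros(1))
    then show ?thesis by simp
  next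
    case False
    then show ?thesis using Cons.IH[of M'] Cons.prems by simp
  qed
qed simp

lemma opt_cost_le: "feasible n k \<sigma> S \<Longrightarrow> opt_cost n k \<sigma> \<le> cost k S"
  unfolding opt_cost_def by (rule cInf_lower) auto

text \<open>This serves an offline request outside the resting cache: put \<open>e\<close> into
  colour 0, then undo that. It costs 1 for \<open>e\<close> and at most 2 for the evicted edges, one
  per endpoint of \<open>e\<close>.\<close>

lemma fetch_and_restore:
  assumes M: "valid_cache n k M" and e: "e \<in> edges n" and k: "0 < k"
  obtains Ms where "\<forall>M'\<in>set Ms. valid_cache n k M'" "last (M # Ms) = M"
    "\<exists>M'\<in>set (M # Ms). cached k M' e"
    "path_cost k M Ms \<le> (if cached k M e then 0 else 3)"
proof (cases "cached k M e")
  case True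
  then show ?thesis using that[of "[]"] by simp
next
  case False
  define D where "D = {f\<in>M 0. fst f = fst e \<or> snd f = snd e}"
  define M' where "M' = M(0 := insert e (M 0 - D))"
  have e_notin: "e \<notin> M i" if "i < k" for i using False that by (auto simp: cached_def)
  have eq: "f = g" if "f \<in> M 0" "g \<in> M 0" "fst f = fst g \<or> snd f = snd g" for f g
    using M k that unfolding valid_cache_def matching_def by blast
  have "valid_cache n k M'"
    using M e e_notin unfolding valid_cache_def M'_def
    by (auto simp: matching_def D_def disjoint_iff)
  have fin: "finite (M 0)" using M k by (rule valid_cache_finite)
  have "add_cost k M M' \<le> (\<Sum>i<k. if i = 0 then 1 else 0)"
    unfolding add_cost_def
  proof (rule sum_mono)
    fix i
    have "insert e (M 0 - D) - M 0 \<subseteq> {e}" by auto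
    then have "card (insert e (M 0 - D) - M 0) \<le> 1"
      by (metis card_mono finite.emptyI finite_insert card.empty card_insert_disjoint
          empty_iff One_nat_def)
    then show "card (M' i - M i) \<le> (if i = 0 then 1 else 0)" by (simp add: M'_def)
  qed
  then have "add_cost k M M' \<le> 1" using k by simp
  moreover have "add_cost k M' M \<le> (\<Sum>i<k. if i = 0 then 2 else 0)"
    unfolding add_cost_def
  proof (rule sum_mono)
    fix i
    have "card {f\<in>M 0. fst f = fst e} \<le> Suc 0"
      by (subst card_le_Suc0_iff_eq) (use fin eq in auto)
    moreover have "card {f\<in>M 0. snd f = snd e} \<le> Suc 0"
      by (subst card_le_Suc0_iff_eq) (use fin eq in auto)
    moreover have "card (M 0 - insert e (M 0 - D)) \<le>
        card ({f\<in>M 0. fst f = fst e} \<union> {f\<in>M 0. snd f = snd e})"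
      using fin by (intro card_mono) (auto simp: D_def)
    moreover have "\<dots> \<le> card {f\<in>M 0. fst f = fst e} + card {f\<in>M 0. snd f = snd e}"
      by (rule card_Un_le)
    ultimately have "card (M 0 - insert e (M 0 - D)) \<le> 2" by linarith
    then show "card (M i - M' i) \<le> (if i = 0 then 2 else 0)" by (simp add: M'_def)
  qed
  then have "add_cost k M' M \<le> 2" using k by simp
  moreover have "cached k M' e" using k by (auto simp: cached_def M'_def)
  ultimately show ?thesis
    using that[of "[M', M]"] False M \<open>valid_cache n k M'\<close> by simp
qed

section \<open>Playing against an online algorithm\<close>

lemma run_snoc: "run A (\<sigma> @ [e]) = run A \<sigma> @ [A (\<sigma> @ [e])]"
  by (simp add: run_def)

lemma run_append: "\<exists>T. run A (\<sigma> @ \<tau>) = run A \<sigma> @ T"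
proof (induction \<tau> rule: rev_induct)
  case (snoc e \<tau>)
  then show ?case using run_snoc[of A "\<sigma> @ \<tau>" e] by auto
qed simp

lemma online_feasible: "online_algorithm n k A \<Longrightarrow> set \<sigma> \<subseteq> edges n \<Longrightarrow> feasible n k \<sigma> (run A \<sigma>)"
  unfolding online_algorithm_def by (simp add: lists_eq_set)

text \<open>By the triangle inequality the caches in between can be ignored, so only the caches at
  the ends of two rounds have to be compared.\<close>

lemma online_add_cost:
  assumes "online_algorithm n k A" "set (\<sigma> @ \<tau>) \<subseteq> edges n"
  shows "cost k (run A \<sigma>) + add_cost k (final_cache (run A \<sigma>)) (final_cache (run A (\<sigma> @ \<tau>)))
    \<le> cost k (run A (\<sigma> @ \<tau>))"
proof -
  obtain T where T: "run A (\<sigma> @ \<tau>) = run A \<sigma> @ T" using run_append by blast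
  have "\<forall>M\<in>set (concat T). valid_cache n k M"
    using feasible_valid[OF online_feasible[OF assms]] unfolding T by auto
  then show ?thesis
    unfolding T cost_append final_cache_append
    by (intro add_left_mono add_cost_le_path_cost)
qed

lemma online_miss:
  assumes A: "online_algorithm n k A" and s: "set \<sigma> \<subseteq> edges n" "e \<in> edges n"
    and e: "\<not> cached k (final_cache (run A \<sigma>)) e"
  shows "cost k (run A \<sigma>) + 1 \<le> cost k (run A (\<sigma> @ [e]))"
proof -
  have "feasible n k (\<sigma> @ [e]) (run A (\<sigma> @ [e]))"
    using s by (intro online_feasible[OF A]) auto
  then show ?thesis
    unfolding run_snoc feasible_snoc cost_snoc using e
    by (intro add_left_mono path_cost_miss) auto
qed

text \<open>The adversary keeps requesting an edge of \<open>E\<close> that is absent from the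
  cache, and each such request costs at least 1. It stops before \<open>m\<close> requests only if
  all of \<open>E\<close> is cached.\<close>

lemma request_missing_edges:
  assumes A: "online_algorithm n k A" and s: "set \<sigma> \<subseteq> edges n" and E: "E \<subseteq> edges n"
  obtains \<tau> where "set \<tau> \<subseteq> E" "length \<tau> \<le> m"
    "cost k (run A \<sigma>) + length \<tau> \<le> cost k (run A (\<sigma> @ \<tau>))"
    "length \<tau> = m \<or> (\<forall>e\<in>E. cached k (final_cache (run A (\<sigma> @ \<tau>))) e)"
proof -
  have "\<exists>\<tau>. set \<tau> \<subseteq> E \<and> length \<tau> \<le> m \<and>
    cost k (run A \<sigma>) + length \<tau> \<le> cost k (run A (\<sigma> @ \<tau>)) \<and>
    (length \<tau> = m \<or> (\<forall>e\<in>E. cached k (final_cache (run A (\<sigma> @ \<tau>))) e))"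
  proof (induction m)
    case (Suc m)
    then obtain \<tau> where \<tau>: "set \<tau> \<subseteq> E" "length \<tau> \<le> m"
      "cost k (run A \<sigma>) + length \<tau> \<le> cost k (run A (\<sigma> @ \<tau>))"
      "length \<tau> = m \<or> (\<forall>e\<in>E. cached k (final_cache (run A (\<sigma> @ \<tau>))) e)" by blast
    show ?case
    proof (cases "\<forall>e\<in>E. cached k (final_cache (run A (\<sigma> @ \<tau>))) e")
      case True
      then show ?thesis using \<tau> by (intro exI[of _ \<tau>]) auto
    next
      case False
      then obtain e where e: "e \<in> E" "\<not> cached k (final_cache (run A (\<sigma> @ \<tau>))) e" by blast
      have "cost k (run A (\<sigma> @ \<tau>)) + 1 \<le> cost k (run A ((\<sigma> @ \<tau>) @ [e]))"
        using s E \<tau>(1) e by (intro online_miss[OF A]) auto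
      then show ?thesis using \<tau> e False by (intro exI[of _ "\<tau> @ [e]"]) auto
    qed
  qed (intro exI[of _ "[]"], simp)
  then show ?thesis using that by blast
qed

lemma competitive_lower_bound:
  fixes a b c :: real
  assumes comp: "competitive n k A c" and "0 < a" "0 < b"
    and hard: "\<And>N::nat. \<exists>\<sigma>. set \<sigma> \<subseteq> edges n \<and> a * N \<le> cost k (run A \<sigma>) \<and>
      opt_cost n k \<sigma> \<le> b * N + e"
  shows "a / b \<le> c"
proof (rule ccontr)
  assume "\<not> a / b \<le> c"
  then have ab: "0 < a - c * b" using \<open>0 < b\<close> by (simp add: field_simps)
  obtain d where d: "\<And>\<sigma>. set \<sigma> \<subseteq> edges n \<Longrightarrow> cost k (run A \<sigma>) \<le> c * opt_cost n k \<sigma> + d"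
    using comp unfolding competitive_def by (auto simp: lists_eq_set)
  \<comment> \<open>\<open>competitive\<close> allows negative \<open>c\<close>. If
    \<open>c * opt_cost\<close> is at most 0, then \<open>a * N \<le> d\<close>; otherwise
    \<open>(a - c * b) * N \<le> c * e + d\<close>. The minimum refutes both for large
    \<open>N\<close>.\<close>
  define x where "x = min a (a - c * b)"
  have x: "0 < x" using ab \<open>0 < a\<close> by (simp add: x_def)
  obtain N :: nat where N: "(\<bar>c * e\<bar> + d) / x < N" using reals_Archimedean2 by blast
  obtain \<sigma> where \<sigma>: "set \<sigma> \<subseteq> edges n" "a * N \<le> cost k (run A \<sigma>)" "opt_cost n k \<sigma> \<le> b * N + e"
    using hard[of N] by blast
  have "a * N \<le> c * opt_cost n k \<sigma> + d" using \<sigma> d by fastforce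
  moreover have "x * N \<le> a * N" "x * N \<le> (a - c * b) * N"
    by (auto simp: x_def intro!: mult_right_mono)
  moreover have "c * opt_cost n k \<sigma> \<le> 0 \<or> c * opt_cost n k \<sigma> \<le> c * (b * N + e)"
    using \<sigma>(3) by (cases "c \<le> 0") (auto simp: mult_nonpos_nonneg intro: mult_left_mono)
  ultimately have "x * N \<le> \<bar>c * e\<bar> + d" by (auto simp: algebra_simps)
  then show False using N x by (simp add: field_simps)
qed

text \<open>Edges at a common node need distinct colours, so at most \<open>k\<close> of the
  \<open>n\<close> edges at the in-node 0 are cached.\<close>

lemma star_not_cached:
  assumes M: "valid_cache n k M" and "k < n"
  shows "\<exists>e\<in>{0} \<times> {..<n}. \<not> cached k M e"
proof (rule ccontr)
  assume "\<not> ?thesis"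
  then have "\<forall>y<n. \<exists>i. i < k \<and> (0, y) \<in> M i" by (auto simp: cached_def)
  then obtain g where g: "\<And>y. y < n \<Longrightarrow> g y < k \<and> (0, y) \<in> M (g y)" by metis
  have "inj_on g {..<n}"
    using g valid_cache_fst[OF M] by (intro inj_onI) (metis lessThan_iff)
  then have "card {..<n} \<le> card {..<k}"
    using g by (intro card_inj_on_le[of g]) auto
  then show False using \<open>k < n\<close> by simp
qed

lemma opt_cost_le_length:
  assumes "set \<sigma> \<subseteq> edges n" "0 < k"
  shows "opt_cost n k \<sigma> \<le> length \<sigma>"
proof -
  let ?A = "\<lambda>\<sigma>. [\<lambda>i. if i = 0 then {last \<sigma>} else {}] :: cache list"
  have "cost k (run ?A \<sigma>) \<le> length \<sigma>" for \<sigma>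
  proof (induction \<sigma> rule: rev_induct)
    case (snoc e \<sigma>)
    have "add_cost k M (\<lambda>i. if i = 0 then {e} else {}) \<le> (\<Sum>i<k. if i = 0 then 1 else 0)" for M
      unfolding add_cost_def by (intro sum_mono) (auto simp: insert_Diff_if)
    then have "add_cost k (final_cache (run ?A \<sigma>)) (\<lambda>i. if i = 0 then {e} else {}) \<le> 1"
      using \<open>0 < k\<close> by fastforce
    then show ?case
      using add_mono[OF snoc] by (fastforce simp: run_snoc cost_snoc cong: if_cong)
  qed (simp add: run_def cost_def)
  moreover have "feasible n k \<sigma> (run ?A \<sigma>)"
    using online_algorithm_exists[of k n] assms by (intro online_feasible) auto
  ultimately show ?thesis using opt_cost_le order_trans by blast
qed

text \<open>This covers small \<open>n / k\<close>, where a long enough chain does not fit. The star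
  at in-node 0 always has a missing edge, so every request costs the algorithm 1; offline, keeping
  only the requested edge costs at most 1 per request.\<close>

lemma competitive_ge_1:
  assumes A: "online_algorithm n k A" and k: "0 < k" "k < n" and c: "competitive n k A c"
  shows "1 \<le> c"
proof -
  have "\<exists>\<sigma>. set \<sigma> \<subseteq> edges n \<and> 1 * real N \<le> cost k (run A \<sigma>) \<and> opt_cost n k \<sigma> \<le> 1 * real N + 0"
    for N :: nat
  proof -
    have E: "{0} \<times> {..<n} \<subseteq> edges n" using k by (auto simp: edges_def)
    obtain \<tau> where \<tau>: "set \<tau> \<subseteq> {0} \<times> {..<n}" "length \<tau> \<le> N"
      "cost k (run A []) + length \<tau> \<le> cost k (run A ([] @ \<tau>))"
      "length \<tau> = N \<or> (\<forall>e\<in>{0} \<times> {..<n}. cached k (final_cache (run A ([] @ \<tau>))) e)"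
      using request_missing_edges[OF A _ E, of "[]" N] by auto
    have s: "set \<tau> \<subseteq> edges n" using \<tau>(1) E by blast
    have "length \<tau> = N"
      using \<tau>(4) star_not_cached[OF final_cache_valid[OF online_feasible[OF A s]] k(2)] by auto
    then show ?thesis
      using \<tau>(3) s opt_cost_le_length[OF s k(1)] by (intro exI[of _ \<tau>]) auto
  qed
  then show ?thesis using competitive_lower_bound[OF c, of 1 1 0] by simp
qed

section \<open>The chain of blocks\<close>

text \<open>Among the nodes with quotient \<open>q\<close> only \<open>q * k\<close> is a multiple
  of \<open>k\<close>, so the removed edge is \<open>(q * k, q * k)\<close>; its ends are the
  \<open>u\<close> and \<open>v\<close> of the overview.\<close>

definition block :: "nat \<Rightarrow> nat \<Rightarrow> edge set" where
  "block k q = {(x, y). x div k = q \<and> y div k = q \<and> \<not> (k dvd x \<and> k dvd y)}"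

definition link :: "nat \<Rightarrow> nat \<Rightarrow> edge" where
  "link k q = (q * k, Suc q * k)"

text \<open>The edge to the extra node \<open>w = 2 * L * k\<close> if \<open>b\<close>, and the middle link otherwise.\<close>

definition switch :: "nat \<Rightarrow> nat \<Rightarrow> bool \<Rightarrow> edge" where
  "switch k L b = ((L - 1) * k, (if b then 2 * L else L) * k)"

definition chain :: "nat \<Rightarrow> nat \<Rightarrow> bool \<Rightarrow> edge set" where
  "chain k L b = (\<Union>q<2 * L. block k q) \<union> link k ` ({..<2 * L} - {L - 1}) \<union> {switch k L b}"

section \<open>Propagation of colours along the chain\<close>

lemma inj_link: "0 < k \<Longrightarrow> inj (link k)"
  by (auto simp: inj_def link_def)

text \<open>If \<open>c\<close> and \<open>c'\<close> differed, each of the \<open>k\<close>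
  out-nodes of the block would have a \<open>c\<close>-edge inside the block. None of these starts
  at in-node \<open>q * k\<close>, whose \<open>c\<close>-edge leaves the block, so \<open>k\<close>
  edges of one matching would share \<open>k - 1\<close> in-nodes.\<close>

lemma block_transmits_colour:
  assumes M: "valid_cache n k M" and k: "0 < k"
    and cov: "\<forall>e\<in>block k q. cached k M e"
    and c: "c < k" "(q * k, y) \<in> M c" "y div k \<noteq> q"
    and c': "c' < k" "(x, q * k) \<in> M c'" "x div k \<noteq> q"
  shows "c = c'"
proof (rule ccontr)
  assume "c \<noteq> c'"
  define V where "V = {q * k..<q * k + k}"
  have V: "finite V" "card V = k" "q * k \<in> V" using k by (auto simp: V_def)
  have div_V: "i div k = q" if "i \<in> V" for i
    using that k unfolding V_def by (auto simp: div_nat_eqI mult.commute)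
  have dvd_V: "i = q * k" if "i \<in> V" "k dvd i" for i
    using div_V[OF that(1)] that(2) by (metis dvd_div_mult_self)
  have "\<forall>e\<in>block k q. \<exists>i. i < k \<and> e \<in> M i" using cov by (auto simp: cached_def)
  then obtain g where g: "\<And>e. e \<in> block k q \<Longrightarrow> g e < k \<and> e \<in> M (g e)" by metis
  have edge: "(i, j) \<in> block k q" if "i \<in> V" "j \<in> V" "i \<noteq> q * k \<or> j \<noteq> q * k" for i j
  proof -
    have "\<not> (k dvd i \<and> k dvd j)" using dvd_V[of i] dvd_V[of j] that by blast
    then show ?thesis using div_V that by (simp add: block_def)
  qed
  \<comment> \<open>The edges from \<open>W\<close> to \<open>j\<close> have distinct colours, all
    in \<open>C\<close>; as \<open>C\<close> is no larger than \<open>W\<close>, every colour of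
    \<open>C\<close> occurs, \<open>c\<close> included.\<close>
  have surj: "\<exists>i\<in>W. (i, j) \<in> M c"
    if W: "\<And>i. i \<in> W \<Longrightarrow> (i, j) \<in> block k q" and C: "C \<subseteq> {..<k}" "card C = card W" "c \<in> C"
      and gC: "\<And>i. i \<in> W \<Longrightarrow> g (i, j) \<in> C" for j W C
  proof -
    have "inj_on (\<lambda>i. g (i, j)) W"
    proof (rule inj_onI)
      fix i i' assume "i \<in> W" "i' \<in> W" and "g (i, j) = g (i', j)"
      then have "g (i, j) < k" "(i, j) \<in> M (g (i, j))" "(i', j) \<in> M (g (i, j))"
        using g[OF W[of i]] g[OF W[of i']] by simp_all
      then show "i = i'" by (rule valid_cache_snd[OF M])
    qed
    then have "card ((\<lambda>i. g (i, j)) ` W) = card C"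
      using C by (simp add: card_image)
    moreover have "finite C" using C(1) finite_subset by blast
    moreover have "(\<lambda>i. g (i, j)) ` W \<subseteq> C" using gC by blast
    ultimately have "(\<lambda>i. g (i, j)) ` W = C" by (intro card_subset_eq)
    then obtain i where "i \<in> W" "c = g (i, j)" using C(3) by blast
    then show ?thesis using g[OF W[of i]] by blast
  qed
  \<comment> \<open>Out-node \<open>q * k\<close> has \<open>k - 1\<close> block edges that avoid
    \<open>c'\<close> and hence use all other colours. Any other out-node has \<open>k\<close> block
    edges, which use all colours.\<close>
  have "\<exists>i\<in>V - {q * k}. (i, j) \<in> M c" if j: "j \<in> V" for j
  proof (cases "j = q * k")
    case True
    have "g (i, j) \<noteq> c'" if i: "i \<in> V - {q * k}" for i
    proof
      assume "g (i, j) = c'"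
      then have "(i, q * k) \<in> M c'" using g[OF edge[of i j]] i j True by simp
      then have "x = i" by (rule valid_cache_snd[OF M c'(1) c'(2)])
      then show False using c'(3) div_V[of i] i by simp
    qed
    moreover have "(i, j) \<in> block k q" if "i \<in> V - {q * k}" for i
      using edge j that by simp
    moreover have "card ({..<k} - {c'}) = card (V - {q * k})"
      using c'(1) V by simp
    ultimately show ?thesis
      using c(1) \<open>c \<noteq> c'\<close> g by (intro surj[where C = "{..<k} - {c'}"]) blast+
  next
    case False
    have "(i, j) \<in> block k q" if "i \<in> V" for i
      using edge j that False by simp
    moreover have "card {..<k} = card V" using V by simp
    ultimately have "\<exists>i\<in>V. (i, j) \<in> M c"
      using c(1) g by (intro surj[where C = "{..<k}"]) blast+
    moreover have "(q * k, j) \<notin> M c"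
    proof
      assume "(q * k, j) \<in> M c"
      then have "y = j" by (rule valid_cache_fst[OF M c(1) c(2)])
      then show False using c(3) div_V[OF j] by simp
    qed
    ultimately show ?thesis by blast
  qed
  then obtain h where h: "\<And>j. j \<in> V \<Longrightarrow> h j \<in> V - {q * k} \<and> (h j, j) \<in> M c" by metis
  have "inj_on h V"
  proof (rule inj_onI)
    fix j j' assume "j \<in> V" "j' \<in> V" "h j = h j'"
    then have "(h j, j) \<in> M c" "(h j, j') \<in> M c" using h[of j] h[of j'] by simp_all
    then show "j = j'" by (rule valid_cache_fst[OF M c(1)])
  qed
  then have "card V \<le> card (V - {q * k})" using h V by (intro card_inj_on_le[of h]) auto
  then show False using V k by simp
qed

text \<open>Block \<open>q + 1\<close> hands the colour of the link entering at its out-node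
  \<open>(q + 1) * k\<close> to the link leaving from its in-node of the same number.\<close>

lemma links_same_colour:
  assumes M: "valid_cache n k M" and k: "0 < k" and c: "c < k" "link k a \<in> M c"
    and cov: "\<And>q. a \<le> q \<Longrightarrow> q < b \<Longrightarrow> cached k M (link k q)"
    "\<And>q e. a \<le> q \<Longrightarrow> q < b \<Longrightarrow> e \<in> block k q \<Longrightarrow> cached k M e"
    and q: "a \<le> q" "q < b"
  shows "link k q \<in> M c"
  using q
proof (induction q rule: nat_induct_at_least)
  case (Suc q)
  obtain c' where c': "c' < k" "link k (Suc q) \<in> M c'"
    using cov(1)[of "Suc q"] Suc by (auto simp: cached_def)
  have "link k q \<in> M c" using Suc by simp
  moreover have "\<forall>e\<in>block k (Suc q). cached k M e" using cov(2)[of "Suc q"] Suc by simp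
  ultimately have "c' = c"
    using block_transmits_colour[OF M k, of "Suc q" c' "Suc (Suc q) * k" c "q * k"] c' c(1) k
    by (simp add: link_def del: mult_Suc)
  then show ?case using c' by simp
qed (rule c)

text \<open>In \<open>M\<close> all links have one colour \<open>c0\<close>. In \<open>M'\<close>
  the links left of the switch have colour \<open>c1\<close>, those right of it \<open>c2\<close>,
  and these differ. So at least one side is recoloured as a whole.\<close>

lemma recolouring_cost:
  assumes M: "valid_cache n k M" and M': "valid_cache n k M'" and k: "0 < k" and L: "2 \<le> L"
    and cov: "\<forall>e\<in>chain k L False. cached k M e" and cov': "\<forall>e\<in>chain k L True. cached k M' e"
  shows "L - 1 \<le> add_cost k M M'"
proof -
  have block: "cached k M e" "cached k M' e" if "e \<in> block k q" "q < 2 * L" for e q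
    using cov cov' that by (auto simp: chain_def)
  have link': "cached k M' (link k q)" if "q < 2 * L" "q \<noteq> L - 1" for q
    using cov' that by (auto simp: chain_def)
  have "switch k L False = link k (L - 1)" using L by (cases L) (auto simp: switch_def link_def)
  then have link: "cached k M (link k q)" if "q < 2 * L" for q
    using cov that by (cases "q = L - 1") (auto simp: chain_def)
  obtain c0 where c0: "c0 < k" "link k 0 \<in> M c0"
    using link[of 0] L by (auto simp: cached_def)
  have all: "link k q \<in> M c0" if "q < 2 * L" for q
    using links_same_colour[OF M k c0, of "2 * L" q] link block that by auto
  obtain c1 where c1: "c1 < k" "link k 0 \<in> M' c1"
    using link'[of 0] L by (auto simp: cached_def)
  have left: "link k q \<in> M' c1" if "q < L - 1" for q
    using links_same_colour[OF M' k c1, of "L - 1" q] link' block that by auto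
  obtain c2 where c2: "c2 < k" "link k L \<in> M' c2"
    using link'[of L] L by (fastforce simp: cached_def)
  have right: "link k q \<in> M' c2" if "L \<le> q" "q < 2 * L" for q
    using links_same_colour[OF M' k c2, of "2 * L" q] link' block that L by auto
  obtain c3 where c3: "c3 < k" "switch k L True \<in> M' c3"
    using cov' by (auto simp: chain_def cached_def)
  \<comment> \<open>This link enters block \<open>L - 1\<close> and the switch leaves it, so the
    switch has the left colour. At \<open>w\<close> the switch meets the last link, so it cannot
    have the right colour.\<close>
  have "link k (L - 2) = ((L - 2) * k, (L - 1) * k)"
    using L by (simp add: link_def Suc_diff_Suc numeral_2_eq_2 del: mult_Suc)
  then have "c3 = c1"
    using block_transmits_colour[OF M' k, of "L - 1" c3 "2 * L * k" c1 "(L - 2) * k"]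
      left[of "L - 2"] block L k c1 c3 by (auto simp: switch_def)
  moreover have "c3 \<noteq> c2"
  proof
    assume "c3 = c2"
    moreover have "link k (2 * L - 1) = ((2 * L - 1) * k, 2 * L * k)"
      using L by (simp add: link_def del: mult_Suc)
    moreover have "link k (2 * L - 1) \<in> M' c2" using L by (intro right) auto
    ultimately have "(L - 1) * k = (2 * L - 1) * k"
      using c3 by (intro valid_cache_snd[OF M' c3(1)]) (auto simp: switch_def)
    then show False using k L by simp
  qed
  ultimately have "c1 \<noteq> c0 \<or> c2 \<noteq> c0" by blast
  moreover have recoloured: "card Q \<le> add_cost k M M'"
    if c: "c < k" "c \<noteq> c0" and Q: "Q \<subseteq> {..<2 * L}" "\<And>q. q \<in> Q \<Longrightarrow> link k q \<in> M' c" for c Q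
  proof -
    have "link k q \<notin> M c" if "q \<in> Q" for q
      using valid_cache_unique[OF M c(1) c0(1) _ all[of q]] c(2) Q(1) that by blast
    then have "link k ` Q \<subseteq> M' c - M c" using Q(2) by blast
    then have "card (link k ` Q) \<le> add_cost k M M'"
      by (rule card_le_add_cost[OF M' c(1)])
    then show ?thesis by (simp add: card_image inj_on_subset[OF inj_link[OF k]])
  qed
  have "L - 1 \<le> add_cost k M M'" if "c1 \<noteq> c0"
    using recoloured[of c1 "{..<L - 1}"] that c1(1) left by fastforce
  moreover have "L \<le> add_cost k M M'" if "c2 \<noteq> c0"
    using recoloured[of c2 "{L..<2 * L}"] that c2(1) right by fastforce
  ultimately show ?thesis by force
qed

section \<open>The offline caches\<close>

text \<open>The block \<open>q\<close> is coloured so that the colour \<open>shift p q\<close> is missing at its two end nodes.\<close>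

definition shift :: "nat \<Rightarrow> nat \<Rightarrow> nat" where
  "shift p q = (if q \<le> p then 0 else 1)"

text \<open>Inside a block this is the addition table modulo \<open>k\<close>, a Latin square,
  displaced so that the removed edge would get \<open>shift p q\<close>. Any other edge takes the
  colour missing in the block it leaves.\<close>

definition colour :: "nat \<Rightarrow> nat \<Rightarrow> edge \<Rightarrow> nat" where
  "colour k p = (\<lambda>(x, y).
     if x div k = y div k then (x mod k + y mod k + shift p (x div k)) mod k
     else shift p (x div k))"

text \<open>The link \<open>p\<close> is left out because it joins blocks with different missing
  colours or, for \<open>p = 2 * L - 1\<close>, may meet the switch at \<open>w\<close> in the same
  colour. The colouring ignores \<open>b\<close>, so a change of graph adds only the new switch
  edge.\<close>

definition offline_cache :: "nat \<Rightarrow> nat \<Rightarrow> nat \<Rightarrow> bool \<Rightarrow> cache" where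
  "offline_cache k L p b = (\<lambda>i. {e \<in> chain k L b - {link k p}. colour k p e = i})"

lemma shift_less: "2 \<le> k \<Longrightarrow> shift p q < k"
  by (simp add: shift_def)

lemma colour_less: "2 \<le> k \<Longrightarrow> colour k p e < k"
  by (auto simp: colour_def shift_less split: prod.split)

text \<open>The index at which the edge leaving block \<open>q\<close> arrives, with
  \<open>2 * L\<close> standing for \<open>w\<close>; links and switch are thus treated
  alike.\<close>

definition successor :: "nat \<Rightarrow> bool \<Rightarrow> nat \<Rightarrow> nat" where
  "successor L b q = (if q = L - 1 then if b then 2 * L else L else Suc q)"

lemma chain_iff:
  assumes "0 < L"
  shows "(x, y) \<in> chain k L b \<longleftrightarrow>
    x div k < 2 * L \<and> y div k = x div k \<and> \<not> (k dvd x \<and> k dvd y) \<or>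
    (\<exists>q<2 * L. x = q * k \<and> y = successor L b q * k)"
proof -
  have "(x, y) \<in> link k ` ({..<2 * L} - {L - 1}) \<union> {switch k L b} \<longleftrightarrow>
    (\<exists>q<2 * L. x = q * k \<and> y = successor L b q * k)"
  proof
    assume "(x, y) \<in> link k ` ({..<2 * L} - {L - 1}) \<union> {switch k L b}"
    then consider q where "q < 2 * L" "q \<noteq> L - 1" "(x, y) = link k q" | "(x, y) = switch k L b"
      by blast
    then show "\<exists>q<2 * L. x = q * k \<and> y = successor L b q * k"
    proof cases
      case 1
      then show ?thesis by (intro exI[of _ q]) (simp add: link_def successor_def)
    next
      case 2
      then show ?thesis using assms
        by (intro exI[of _ "L - 1"]) (simp add: switch_def successor_def)
    qed
  next
    assume "\<exists>q<2 * L. x = q * k \<and> y = successor L b q * k"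
    then obtain q where "q < 2 * L" "x = q * k" "y = successor L b q * k" by blast
    then show "(x, y) \<in> link k ` ({..<2 * L} - {L - 1}) \<union> {switch k L b}"
      by (cases "q = L - 1") (auto simp: link_def switch_def successor_def)
  qed
  moreover have "(x, y) \<in> (\<Union>q<2 * L. block k q) \<longleftrightarrow>
      x div k < 2 * L \<and> y div k = x div k \<and> \<not> (k dvd x \<and> k dvd y)"
    by (auto simp: block_def)
  ultimately show ?thesis unfolding chain_def by blast
qed

lemma chain_subset_edges:
  assumes "0 < k" "0 < L" "2 * L * k < n"
  shows "chain k L b \<subseteq> edges n"
proof
  fix e assume "e \<in> chain k L b"
  moreover obtain x y where e: "e = (x, y)" by (cases e)
  ultimately consider "x div k < 2 * L" "y div k < 2 * L"
    | q where "q < 2 * L" "x = q * k" "y = successor L b q * k"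
    using chain_iff[OF assms(2)] by auto
  then have "x \<le> 2 * L * k \<and> y \<le> 2 * L * k"
  proof cases
    case 1
    then show ?thesis using assms(1) by (simp add: div_less_iff_less_mult less_imp_le)
  next
    case 2
    then have "successor L b q \<le> 2 * L" by (auto simp: successor_def)
    then show ?thesis using 2 by simp
  qed
  then show "e \<in> edges n" using assms(3) by (simp add: e edges_def)
qed

section \<open>Properness of the offline colouring\<close>

lemma mod_add_cancel:
  fixes a b s k :: nat
  assumes "(a + s) mod k = (b + s) mod k" "a < k" "b < k"
  shows "a = b"
  using assms by (metis cong_add_rcancel_nat cong_def mod_less)

text \<open>At an end node one residue is 0 and the other is not, so their sum lies strictly between
  0 and \<open>k\<close> and moves the colour away from \<open>shift\<close>.\<close>

lemma colour_block_end:
  assumes k: "2 \<le> k" and "y div k = x div k" "\<not> (k dvd x \<and> k dvd y)" "k dvd x \<or> k dvd y"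
  shows "colour k p (x, y) \<noteq> shift p (x div k)"
proof
  assume "colour k p (x, y) = shift p (x div k)"
  then have "(x mod k + y mod k + shift p (x div k)) mod k = (0 + shift p (x div k)) mod k"
    using assms(2) shift_less[OF k] by (simp add: colour_def)
  moreover have "x mod k + y mod k < k" using assms(4) k by (auto simp: dvd_eq_mod_eq_0)
  ultimately have "x mod k + y mod k = 0" using k by (intro mod_add_cancel[where b = 0]) auto
  then show False using assms(3) by (auto simp: dvd_eq_mod_eq_0)
qed

text \<open>Only the switch and link \<open>2 * L - 1\<close> can share an out-node, namely
  \<open>w\<close>. If that link is not \<open>p\<close>, it lies after \<open>p\<close> and has
  shift 1, whereas the switch starts before \<open>p\<close> and has shift 0.\<close>

lemma successor_inj:
  assumes "L \<le> p" "p < 2 * L" "q < 2 * L" "q' < 2 * L" "q \<noteq> p" "q' \<noteq> p"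
    and shift: "shift p q = shift p q'" and eq: "successor L b q = successor L b q'"
  shows "q = q'"
proof (rule ccontr)
  have *: False
    if q: "q = L - 1" "q' \<noteq> L - 1" "q' < 2 * L" "q' \<noteq> p" "shift p q = shift p q'"
      "successor L b q = successor L b q'" for q q'
  proof -
    have "L = Suc q' \<or> Suc q' = 2 * L"
      using q(6) unfolding q(1) using q(2) by (cases b) (simp_all add: successor_def)
    then have "Suc q' = 2 * L" using q(2) by auto
    then have "\<not> q' \<le> p" using assms(2) q(4) by arith
    then have "shift p q' = 1" by (simp add: shift_def)
    moreover have "L - 1 \<le> p" using assms(1) by arith
    then have "shift p (L - 1) = 0" by (simp add: shift_def)
    ultimately show False using q(1,5) by simp
  qed
  assume "q \<noteq> q'"
  show False
  proof (cases "q = L - 1")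
    case True
    then show False using *[OF True _ assms(4,6) shift eq] \<open>q \<noteq> q'\<close> by simp
  next
    case False
    have "q' = L - 1"
    proof (rule ccontr)
      assume "q' \<noteq> L - 1"
      then show False using eq False \<open>q \<noteq> q'\<close> by (simp add: successor_def)
    qed
    then show False using False by (rule *[OF _ _ assms(3,5) shift[symmetric] eq[symmetric]])
  qed
qed

text \<open>Two block edges are separated by cancellation in the Latin square, a block edge and a
  link by the colour missing at the end node, and two links by \<open>successor_inj\<close>.\<close>

lemma colour_proper:
  assumes k: "2 \<le> k" and p: "L \<le> p" "p < 2 * L"
    and e: "(x, y) \<in> chain k L b - {link k p}" "(x', y') \<in> chain k L b - {link k p}"
    and col: "colour k p (x, y) = colour k p (x', y')" and adj: "x = x' \<or> y = y'"
  shows "(x, y) = (x', y')"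
proof -
  have L: "0 < L" using p by simp
  \<comment> \<open>The last fact says that both blocks at a kept link miss the same colour:
    \<open>shift\<close> changes only from \<open>p\<close> to \<open>p + 1\<close>.\<close>
  have link: "q \<noteq> p" "colour k p (q * k, successor L b q * k) = shift p q"
    "successor L b q < 2 * L \<Longrightarrow> shift p (successor L b q) = shift p q"
    if "q < 2 * L" "(q * k, successor L b q * k) \<noteq> link k p" for q
  proof -
    show qp: "q \<noteq> p"
    proof
      assume "q = p"
      moreover have "successor L b p = Suc p" using p L by (auto simp: successor_def)
      ultimately show False using that(2) by (simp add: link_def)
    qed
    have "successor L b q \<noteq> q" using L by (auto simp: successor_def)
    then show "colour k p (q * k, successor L b q * k) = shift p q"
      using k by (simp add: colour_def)
    show "shift p (successor L b q) = shift p q" if "successor L b q < 2 * L"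
      using that p qp by (auto simp: successor_def shift_def)
  qed
  have mixed: "False"
    if B: "x div k < 2 * L" "y div k = x div k" "\<not> (k dvd x \<and> k dvd y)"
      and q: "q < 2 * L" "(q * k, successor L b q * k) \<noteq> link k p"
      and c: "colour k p (x, y) = colour k p (q * k, successor L b q * k)"
      and a: "x = q * k \<or> y = successor L b q * k" for x y q
  proof -
    have "shift p (x div k) = shift p q" using a B link(3)[OF q] k by auto
    moreover have "k dvd x \<or> k dvd y" using a by auto
    ultimately show False using colour_block_end[OF k B(2,3), of p] c link(2)[OF q] by simp
  qed
  define B where "B x y \<longleftrightarrow> x div k < 2 * L \<and> y div k = x div k \<and> \<not> (k dvd x \<and> k dvd y)" for x y
  define N where "N q x y \<longleftrightarrow> q < 2 * L \<and> x = q * k \<and> y = successor L b q * k" for q x y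
  have "B x y \<or> (\<exists>q. N q x y)" "B x' y' \<or> (\<exists>q. N q x' y')"
    using e unfolding B_def N_def by (simp_all add: chain_iff[OF L])
  then consider (blocks) "B x y" "B x' y'" | (left) q where "B x y" "N q x' y'"
    | (right) q where "B x' y'" "N q x y" | (links) q q' where "N q x y" "N q' x' y'"
    by blast
  then show ?thesis
  proof cases
    case blocks
    note blocks = blocks[unfolded B_def]
    have d: "x div k = x' div k" "y div k = y' div k" using adj blocks by auto
    have "x mod k = x' mod k \<and> y mod k = y' mod k"
    proof (cases "x = x'")
      case True
      then have "(y mod k + (x mod k + shift p (x div k))) mod k =
          (y' mod k + (x mod k + shift p (x div k))) mod k"
        using col blocks by (simp add: colour_def add_ac)
      then show ?thesis using True k mod_add_cancel[of "y mod k"] by simp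
    next
      case False
      then have "(x mod k + (y mod k + shift p (x div k))) mod k =
          (x' mod k + (y mod k + shift p (x div k))) mod k"
        using col adj blocks d by (simp add: colour_def add_ac)
      then show ?thesis using False adj k mod_add_cancel[of "x mod k"] by simp
    qed
    then show ?thesis using d by (metis div_mult_mod_eq)
  next
    case left
    then show ?thesis using mixed[of x y q] e(2) col adj unfolding B_def N_def by auto
  next
    case right
    then show ?thesis using mixed[of x' y' q] e(1) col adj unfolding B_def N_def by auto
  next
    case links
    note links = links[unfolded N_def]
    have "shift p q = shift p q'" "q \<noteq> p" "q' \<noteq> p" using link links e col by auto
    moreover have "q = q' \<or> successor L b q = successor L b q'" using adj links k by auto
    moreover have "q < 2 * L" "q' < 2 * L" using links by auto
    ultimately have "q = q'" using successor_inj[OF p] by blast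
    then show ?thesis using links by simp
  qed
qed

section \<open>Offline schedules and their costs\<close>

lemma offline_cache_valid:
  assumes "2 \<le> k" "L \<le> p" "p < 2 * L" "2 * L * k < n"
  shows "valid_cache n k (offline_cache k L p b)"
  unfolding valid_cache_def
proof (intro conjI allI impI)
  fix i
  show "offline_cache k L p b i \<subseteq> edges n"
    using chain_subset_edges[of k L n b] assms by (auto simp: offline_cache_def)
  show "matching (offline_cache k L p b i)"
    unfolding matching_def
  proof (intro ballI impI)
    fix e f assume "e \<in> offline_cache k L p b i" "f \<in> offline_cache k L p b i" "e \<noteq> f"
    then show "fst e \<noteq> fst f \<and> snd e \<noteq> snd f"
      using colour_proper[OF assms(1-3), of "fst e" "snd e" b "fst f" "snd f"]
      by (auto simp: offline_cache_def)
  qed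
qed (auto simp: offline_cache_def)

lemma offline_cache_cached:
  "2 \<le> k \<Longrightarrow> cached k (offline_cache k L p b) e \<longleftrightarrow> e \<in> chain k L b \<and> e \<noteq> link k p"
  by (auto simp: cached_def offline_cache_def colour_less)

lemma offline_cache_change:
  assumes "2 \<le> k"
  shows "add_cost k (offline_cache k L p b) (offline_cache k L p b') \<le> 1"
proof -
  define i0 where "i0 = colour k p (switch k L b')"
  have "add_cost k (offline_cache k L p b) (offline_cache k L p b')
      \<le> (\<Sum>i<k. if i = i0 then 1 else 0)"
    unfolding add_cost_def
  proof (rule sum_mono)
    fix i
    have "offline_cache k L p b' i - offline_cache k L p b i \<subseteq> (if i = i0 then {switch k L b'} else {})"
      by (auto simp: offline_cache_def chain_def i0_def)
    then have "card (offline_cache k L p b' i - offline_cache k L p b i)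
        \<le> card (if i = i0 then {switch k L b'} else {})"
      by (intro card_mono) auto
    then show "card (offline_cache k L p b' i - offline_cache k L p b i) \<le> (if i = i0 then 1 else 0)"
      by (auto split: if_splits)
  qed
  then show ?thesis using colour_less[OF assms] by (simp add: i0_def)
qed

text \<open>The flag \<open>b\<close> is existential because an empty round leaves the cache of the
  previous graph in place.\<close>

definition offline_bound :: "nat \<Rightarrow> nat \<Rightarrow> nat \<Rightarrow> nat \<Rightarrow> edge list \<Rightarrow> nat \<Rightarrow> bool" where
  "offline_bound n k L p \<sigma> B \<longleftrightarrow>
     (\<exists>S b. feasible n k \<sigma> S \<and> cost k S \<le> B \<and> final_cache S = offline_cache k L p b)"

text \<open>A schedule can act only while handling a request, so one request is spent on building
  the resting cache. It goes to the middle link, which is not \<open>p\<close> since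
  \<open>L \<le> p\<close>.\<close>

lemma offline_bound_start:
  assumes "2 \<le> k" "L \<le> p" "p < 2 * L" "2 * L * k < n"
  shows "offline_bound n k L p [switch k L False] (add_cost k empty_cache (offline_cache k L p False))"
proof -
  let ?M = "offline_cache k L p False"
  have "switch k L False \<noteq> link k p" using assms by (auto simp: switch_def link_def)
  then have "cached k ?M (switch k L False)"
    using assms(1) by (simp add: offline_cache_cached chain_def)
  then have "feasible n k ([] @ [switch k L False]) ([] @ [[?M]])"
    unfolding feasible_snoc using offline_cache_valid[OF assms] by (simp add: feasible_def)
  then show ?thesis
    unfolding offline_bound_def by (intro exI[of _ "[[?M]]"]) (auto simp: cost_def final_cache_def)
qed

lemma offline_bound_round:
  assumes k: "2 \<le> k" and p: "L \<le> p" "p < 2 * L" and n: "2 * L * k < n"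
    and bound: "offline_bound n k L p \<sigma> B" and \<tau>: "set \<tau> \<subseteq> chain k L b"
  shows "offline_bound n k L p (\<sigma> @ \<tau>) (B + 1 + 3 * count_list \<tau> (link k p))"
proof -
  let ?M = "offline_cache k L p b"
  from bound obtain S b0
    where S: "feasible n k \<sigma> S" "cost k S \<le> B" "final_cache S = offline_cache k L p b0"
    unfolding offline_bound_def by (elim exE conjE)
  \<comment> \<open>Before the first request of the round the cache may still belong to the other
    graph; this is the first disjunct.\<close>
  have "\<exists>S'. feasible n k (\<sigma> @ \<tau>) S' \<and> (\<tau> = [] \<and> S' = S \<or>
      final_cache S' = ?M \<and> cost k S' \<le> B + 1 + 3 * count_list \<tau> (link k p))"
    using \<tau>
  proof (induction \<tau> rule: rev_induct)
    case Nil
    then show ?case using S by auto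
  next
    case (snoc e \<tau>)
    then obtain S' where S': "feasible n k (\<sigma> @ \<tau>) S'" "\<tau> = [] \<and> S' = S \<or>
      final_cache S' = ?M \<and> cost k S' \<le> B + 1 + 3 * count_list \<tau> (link k p)" by auto
    have change: "cost k S' + add_cost k (final_cache S') ?M \<le> B + 1 + 3 * count_list \<tau> (link k p)"
      using S'(2)
    proof (elim disjE conjE)
      assume "\<tau> = []" "S' = S"
      then show ?thesis using S offline_cache_change[OF k, of L p b0 b] by simp
    qed simp
    have valid: "valid_cache n k ?M" using offline_cache_valid k p n by blast
    have e: "e \<in> chain k L b" using snoc.prems by simp
    then have "e \<in> edges n" using chain_subset_edges[of k L n b] k p n by auto
    then obtain Ms where Ms: "\<forall>M'\<in>set Ms. valid_cache n k M'" "last (?M # Ms) = ?M"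
      "\<exists>M'\<in>set (?M # Ms). cached k M' e" "path_cost k ?M Ms \<le> (if cached k ?M e then 0 else 3)"
      using fetch_and_restore[OF valid, of e] k by auto
    \<comment> \<open>Each request first moves to \<open>?M\<close>, which is free after the first
      request. Only link \<open>p\<close> can be missing there, so only it needs a fetch.\<close>
    have "feasible n k ((\<sigma> @ \<tau>) @ [e]) (S' @ [?M # Ms])"
      unfolding feasible_snoc using S'(1) valid Ms by auto
    moreover have "final_cache (S' @ [?M # Ms]) = ?M"
      unfolding final_cache_snoc using Ms(2) by simp
    moreover have "path_cost k ?M Ms \<le> 3 * count_list [e] (link k p)"
      using Ms(4) e by (auto simp: offline_cache_cached[OF k])
    then have "cost k (S' @ [?M # Ms]) \<le> B + 1 + 3 * count_list (\<tau> @ [e]) (link k p)"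
      unfolding cost_snoc count_list_append using change by simp
    ultimately show ?case by (metis append.assoc)
  qed
  then obtain S' where S': "feasible n k (\<sigma> @ \<tau>) S'" "\<tau> = [] \<and> S' = S \<or>
      final_cache S' = ?M \<and> cost k S' \<le> B + 1 + 3 * count_list \<tau> (link k p)" by blast
  then show ?thesis unfolding offline_bound_def using S by fastforce
qed

section \<open>The lower bound\<close>

text \<open>Distinct positions have distinct links, so each request is counted for at most one
  \<open>p\<close>.\<close>

lemma sum_count_links:
  assumes "0 < k" "finite P"
  shows "(\<Sum>p\<in>P. count_list \<tau> (link k p)) \<le> length \<tau>"
proof (induction \<tau>)
  case (Cons e \<tau>)
  have "(\<Sum>p\<in>P. if e = link k p then 1 else 0) = card {p\<in>P. e = link k p}"
    using assms(2) by (simp add: sum.If_cases Int_def)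
  also have "\<dots> \<le> Suc 0"
    using inj_link[OF assms(1)] assms(2) by (subst card_le_Suc0_iff_eq) (auto dest: injD)
  finally have "(\<Sum>p\<in>P. if e = link k p then 1 else 0) \<le> Suc 0" .
  moreover have "(\<Sum>p\<in>P. count_list (e # \<tau>) (link k p)) =
      (\<Sum>p\<in>P. if e = link k p then 1 else 0) + (\<Sum>p\<in>P. count_list \<tau> (link k p))"
    by (subst sum.distrib[symmetric]) (rule sum.cong, auto)
  ultimately show ?case using Cons by simp
qed simp

text \<open>If a round uses up its \<open>L\<close> requests, the algorithm has paid
  \<open>L\<close>. Otherwise it caches each graph completely at the end of the corresponding round
  and has paid for recolouring.\<close>

lemma two_rounds:
  assumes A: "online_algorithm n k A" and k: "2 \<le> k" and L: "2 \<le> L" and n: "2 * L * k < n"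
    and \<sigma>: "set \<sigma> \<subseteq> edges n"
  obtains \<tau> \<tau>' where "set \<tau> \<subseteq> chain k L False" "set \<tau>' \<subseteq> chain k L True"
    "length \<tau> \<le> L" "length \<tau>' \<le> L"
    "cost k (run A \<sigma>) + (L - 1) \<le> cost k (run A (\<sigma> @ \<tau> @ \<tau>'))"
proof -
  have E: "chain k L b \<subseteq> edges n" for b using chain_subset_edges k L n by auto
  obtain \<tau> where \<tau>: "set \<tau> \<subseteq> chain k L False" "length \<tau> \<le> L"
    "cost k (run A \<sigma>) + length \<tau> \<le> cost k (run A (\<sigma> @ \<tau>))"
    "length \<tau> = L \<or> (\<forall>e\<in>chain k L False. cached k (final_cache (run A (\<sigma> @ \<tau>))) e)"
    by (rule request_missing_edges[OF A \<sigma> E])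
  have \<sigma>\<tau>: "set (\<sigma> @ \<tau>) \<subseteq> edges n" using \<sigma> \<tau>(1) E by auto
  obtain \<tau>' where \<tau>': "set \<tau>' \<subseteq> chain k L True" "length \<tau>' \<le> L"
    "cost k (run A (\<sigma> @ \<tau>)) + length \<tau>' \<le> cost k (run A ((\<sigma> @ \<tau>) @ \<tau>'))"
    "length \<tau>' = L \<or> (\<forall>e\<in>chain k L True. cached k (final_cache (run A ((\<sigma> @ \<tau>) @ \<tau>'))) e)"
    by (rule request_missing_edges[OF A \<sigma>\<tau> E])
  have \<sigma>\<tau>\<tau>': "set ((\<sigma> @ \<tau>) @ \<tau>') \<subseteq> edges n" using \<sigma>\<tau> \<tau>'(1) E by auto
  consider "length \<tau> = L" | "length \<tau>' = L"
    | "\<forall>e\<in>chain k L False. cached k (final_cache (run A (\<sigma> @ \<tau>))) e"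
      "\<forall>e\<in>chain k L True. cached k (final_cache (run A ((\<sigma> @ \<tau>) @ \<tau>'))) e"
    using \<tau>(4) \<tau>'(4) by blast
  then have "cost k (run A \<sigma>) + (L - 1) \<le> cost k (run A ((\<sigma> @ \<tau>) @ \<tau>'))"
  proof cases
    case 3
    have "L - 1 \<le> add_cost k (final_cache (run A (\<sigma> @ \<tau>))) (final_cache (run A ((\<sigma> @ \<tau>) @ \<tau>')))"
      using 3 k L final_cache_valid[OF online_feasible[OF A \<sigma>\<tau>]]
        final_cache_valid[OF online_feasible[OF A \<sigma>\<tau>\<tau>']]
      by (intro recolouring_cost) auto
    then show ?thesis using online_add_cost[OF A \<sigma>\<tau>\<tau>'] \<tau>(3) by simp
  qed (use \<tau>(3) \<tau>'(3) in linarith)+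
  then show ?thesis using that \<tau> \<tau>' by simp
qed

text \<open>All offline positions are tracked at once on one request sequence. The start-up cost
  \<open>K\<close> does not depend on \<open>N\<close> and ends in the additive constant.\<close>

lemma hard_sequences:
  assumes A: "online_algorithm n k A" and k: "2 \<le> k" and L: "2 \<le> L" and n: "2 * L * k < n"
  defines "P \<equiv> {L..<2 * L}"
  defines "K \<equiv> \<Sum>p\<in>P. add_cost k empty_cache (offline_cache k L p False)"
  shows "\<exists>\<sigma> B. set \<sigma> \<subseteq> edges n \<and> (L - 1) * N \<le> cost k (run A \<sigma>) \<and>
    (\<forall>p\<in>P. offline_bound n k L p \<sigma> (B p)) \<and> sum B P \<le> K + 8 * L * N"
proof (induction N)
  case 0
  have "switch k L False \<in> chain k L False" unfolding chain_def by blast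
  then have "switch k L False \<in> edges n"
    using chain_subset_edges[of k L n False] k L n by auto
  then show ?case
    using offline_bound_start[OF k _ _ n]
    by (intro exI[of _ "[switch k L False]"]
        exI[of _ "\<lambda>p. add_cost k empty_cache (offline_cache k L p False)"])
      (auto simp: P_def K_def)
next
  case (Suc N)
  then obtain \<sigma> B where \<sigma>: "set \<sigma> \<subseteq> edges n" "(L - 1) * N \<le> cost k (run A \<sigma>)"
    "\<And>p. p \<in> P \<Longrightarrow> offline_bound n k L p \<sigma> (B p)" "sum B P \<le> K + 8 * L * N" by blast
  obtain \<tau> \<tau>' where \<tau>: "set \<tau> \<subseteq> chain k L False" "set \<tau>' \<subseteq> chain k L True"
    "length \<tau> \<le> L" "length \<tau>' \<le> L"
    "cost k (run A \<sigma>) + (L - 1) \<le> cost k (run A (\<sigma> @ \<tau> @ \<tau>'))"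
    using two_rounds[OF A k L n \<sigma>(1)] .
  define B' where "B' p = B p + 1 + 3 * count_list \<tau> (link k p) + 1 + 3 * count_list \<tau>' (link k p)" for p
  have "set (\<sigma> @ \<tau> @ \<tau>') \<subseteq> edges n"
    using chain_subset_edges[of k L n] k L n \<sigma>(1) \<tau>(1,2) by fastforce
  moreover have "(L - 1) * Suc N \<le> cost k (run A (\<sigma> @ \<tau> @ \<tau>'))"
    using \<sigma>(2) \<tau>(5) by simp
  moreover have "offline_bound n k L p (\<sigma> @ \<tau> @ \<tau>') (B' p)" if "p \<in> P" for p
    using offline_bound_round[OF k _ _ n offline_bound_round[OF k _ _ n \<sigma>(3) \<tau>(1)] \<tau>(2), of p] that
    by (simp add: P_def B'_def)
  \<comment> \<open>Two changes of graph for each of \<open>L\<close> positions give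
    \<open>2 * L\<close>, and fetching gives at most \<open>3 * L\<close> in each of the two rounds:
    \<open>8 * L\<close> in total.\<close>
  moreover have "sum B' P = sum B P + 2 * L + 3 * (\<Sum>p\<in>P. count_list \<tau> (link k p))
      + 3 * (\<Sum>p\<in>P. count_list \<tau>' (link k p))"
    unfolding B'_def sum.distrib sum_distrib_left by (simp add: P_def)
  then have "sum B' P \<le> K + 8 * L * Suc N"
    using \<sigma>(4) \<tau>(3,4) sum_count_links[of k P \<tau>] sum_count_links[of k P \<tau>'] k by (simp add: P_def)
  ultimately show ?case by blast
qed

lemma competitive_ge_chain:
  assumes A: "online_algorithm n k A" and k: "2 \<le> k" and L: "2 \<le> L" and n: "2 * L * k < n"
    and c: "competitive n k A c"
  shows "(real L - 1) / 8 \<le> c"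
proof -
  define P where "P = {L..<2 * L}"
  define K where "K = (\<Sum>p\<in>P. add_cost k empty_cache (offline_cache k L p False))"
  have "\<exists>\<sigma>. set \<sigma> \<subseteq> edges n \<and> (real L - 1) * real N \<le> cost k (run A \<sigma>) \<and>
      opt_cost n k \<sigma> \<le> 8 * real N + real K" for N :: nat
  proof -
    obtain \<sigma> B where \<sigma>: "set \<sigma> \<subseteq> edges n" "(L - 1) * N \<le> cost k (run A \<sigma>)"
      "\<And>p. p \<in> P \<Longrightarrow> offline_bound n k L p \<sigma> (B p)" "sum B P \<le> K + 8 * L * N"
      using hard_sequences[OF A k L n, of N] unfolding P_def K_def by blast
    have "opt_cost n k \<sigma> \<le> B p" if "p \<in> P" for p
      using \<sigma>(3)[OF that] opt_cost_le order_trans unfolding offline_bound_def by blast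
    \<comment> \<open>The optimum is at most the best position and hence at most the average over
      the \<open>L\<close> positions.\<close>
    then have "card P * opt_cost n k \<sigma> \<le> sum B P"
      using sum_mono[of P "\<lambda>_. opt_cost n k \<sigma>" B] by simp
    also have "\<dots> \<le> L * (8 * N + K)"
    proof -
      have "K \<le> L * K" using L by simp
      moreover have "L * (8 * N + K) = 8 * L * N + L * K" by (simp add: algebra_simps)
      ultimately show ?thesis using \<sigma>(4) by linarith
    qed
    finally have "opt_cost n k \<sigma> \<le> 8 * N + K" using L by (simp add: P_def)
    moreover have "real ((L - 1) * N) \<le> real (cost k (run A \<sigma>))"
      using \<sigma>(2) by (rule of_nat_mono)
    ultimately show ?thesis
      using \<sigma>(1) L by (intro exI[of _ \<sigma>]) (auto simp: of_nat_diff)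
  qed
  then show ?thesis using competitive_lower_bound[OF c, of "real L - 1" 8 K] L by simp
qed

text \<open>The constant is 1/48 since \<open>c\<close> is at least \<open>(L - 1) / 8\<close> and
  \<open>n / k\<close> is at most \<open>6 * (L - 1)\<close>. For \<open>n \<le> 4 * k\<close> the
  claimed bound is below 1.\<close>

lemma competitive_ge:
  assumes A: "online_algorithm n k A" and k: "2 \<le> k" "k < n" and c: "competitive n k A c"
  shows "1 / 48 * (real n / real k) \<le> c"
proof (cases "n \<le> 4 * k")
  case True
  then have "real n / real k \<le> 4" using k by (simp add: field_simps)
  then show ?thesis using competitive_ge_1[OF A _ k(2) c] k by simp
next
  case False
  \<comment> \<open>The largest \<open>L\<close> with \<open>2 * L * k < n\<close>; the strict
    inequality leaves room for \<open>w\<close>.\<close>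
  define L where "L = (n - 1) div (2 * k)"
  have "2 \<le> L" unfolding L_def using False k by (simp add: less_eq_div_iff_mult_less_eq)
  have "2 * L * k \<le> n - 1" unfolding L_def by (metis div_times_less_eq_dividend mult.assoc mult.commute)
  then have "(real L - 1) / 8 \<le> c"
    using competitive_ge_chain[OF A k(1) \<open>2 \<le> L\<close> _ c] k by simp
  moreover have "real n / real k \<le> 6 * (real L - 1)"
  proof -
    have "n - 1 < 2 * k * (L + 1)"
      unfolding L_def using k dividend_less_div_times[of "2 * k" "n - 1"] by (simp add: algebra_simps)
    then have "n \<le> 2 * k * (L + 1)" by simp
    \<comment> \<open>\<open>L + 1 \<le> 3 * (L - 1)\<close> is where \<open>2 \<le> L\<close>
      enters.\<close>
    also have "\<dots> \<le> 2 * k * (3 * (L - 1))" using \<open>2 \<le> L\<close> by (intro mult_le_mono2) simp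
    finally have "real n \<le> real (2 * k * (3 * (L - 1)))" by (rule of_nat_mono)
    then show ?thesis using k \<open>2 \<le> L\<close> by (simp add: of_nat_diff field_simps)
  qed
  ultimately show ?thesis by simp
qed

theorem theorem8:
  "\<exists>C::real. C > 0 \<and>
     (\<forall>n k :: nat. 2 \<le> k \<and> k < n \<longrightarrow>
        (\<forall>A. online_algorithm n k A \<longrightarrow>
           competitive_ratio n k A \<ge> ereal (C * (real n / real k))))"
proof (intro exI[of _ "1 / 48"] conjI allI impI)
  fix n k :: nat and A
  assume "2 \<le> k \<and> k < n" and "online_algorithm n k A"
  then show "ereal (1 / 48 * (real n / real k)) \<le> competitive_ratio n k A"
    unfolding competitive_ratio_def
    by (intro Inf_greatest) (auto simp only: mem_Collect_eq ereal_less_eq intro!: competitive_ge)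
qed simp

end
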